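(* Let $a>0$, $0\le b_{\min}<b_{\max}$, $k_1,k_2\in\mathbb{R}$ be constants, let $f\in C^1([0,a];\mathbb{R})$ satisfy $0\le f(x)\le x$ for all $x\in[0,a]$, and let $(x^*,u^*,v^* )\in(0,a)\times(b_{\min},b_{\max})\times[0,+\infty)$ satisfy $f(x^* )=u^*+v^*<a-x^*$. Put $\sigma:=k_1+k_2$ and consider the planar discrete-time system $(\ast)$ defined in the context, for which $(x^*,u^* )$ is an equilibrium point. Suppose that the equilibrium point $(x^*,u^* )$ of $(\ast)$ is locally exponentially stable. Moreover, suppose that $0<k_2<2$ and $$|f'(x^* )-1+k_1|<\frac{1-|1-k_2|}{k_2+1-|1-k_2|}.$$ Let $\eta>0$ be a constant for which $$\max\{|f'(x)-1+k_1|:x\in[0,a],\ |x-x^*|\le\eta\}=\frac{1-|1-k_2|}{k_2+1-|1-k_2|}$$ and such that $|f'(x)-1+k_1|<\dfrac{1-|1-k_2|}{k_2+1-|1-k_2|}$ for all $x\in[0,a]$ with $|x-x^*|<\eta$. Define $$\rho:=\min\left(\eta,\ \frac{\min(b_{\max}-u^*,\,u^*-b_{\min})}{\max\left(\dfrac{k_2|1-\sigma|}{k_2+1-|1-k_2|},\ \dfrac{1-|1-k_2|}{k_2+1-|1-k_2|}+|(1-\sigma)(k_2-1)|\right)},\ \frac{a-v^*-u^*-x^*}{1+\dfrac{1-|1-k_2|}{k_2+1-|1-k_2|}+|\sigma-1|}\right).$$ Then every solution $(x(t),w(t))\in[0,a]\times\mathbb{R}$ of $(\ast)$ with initial condition $$(x(0),w(0))\in\Omega_\rho=\Big\{(x,w)\in[0,a]\times\mathbb{R}:\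 |x-x^*|+\frac{k_2+1-|1-k_2|}{k_2}\,|w+v^*-f(x)+k_2(x-x^* )|<\rho\Big\}$$ satisfies $\lim_{t\to+\infty}(x(t),w(t))=(x^*,u^* )$.
   Context: Let $P(s):=\max(b_{\min},\min(s,b_{\max}))$ for $s\in\mathbb{R}$. The system $(\ast)$, with state $(x,w)\in[0,a]\times\mathbb{R}$, is $$x(t+1)=x(t)-f(x(t))+\min\big(w(t)+v^*,\,a-x(t)\big),$$ $$w(t+1)=P\Big(w(t)+\sigma f(x(t))-\sigma\min\big(w(t)+v^*,\,a-x(t)\big)-k_2(x(t)-x^* )\Big).$$ A solution is a sequence $(x(t),w(t))_{t\ge0}$ in $[0,a]\times\mathbb{R}$ satisfying these equations for all $t\ge0$. The equilibrium $(x^*,u^* )$ is locally exponentially stable if there are $\delta>0$, $C\ge1$, $\mu\in(0,1)$ such that every solution with $|(x(0)-x^*,w(0)-u^* )|<\delta$ satisfies $|(x(t)-x^*,w(t)-u^* )|\le C\mu^t|(x(0)-x^*,w(0)-u^* )|$ for all $t\ge0$. *)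

theory Defs
  imports "HOL-Analysis.Analysis"
begin

definition sat :: "real \<Rightarrow> real \<Rightarrow> real \<Rightarrow> real" where
  "sat b_min b_max s = max b_min (min s b_max)"

definition step :: "real \<Rightarrow> real \<Rightarrow> real \<Rightarrow> real \<Rightarrow> real \<Rightarrow> (real \<Rightarrow> real) \<Rightarrow> real \<Rightarrow> real
    \<Rightarrow> real \<times> real \<Rightarrow> real \<times> real" where
  "step a b_min b_max \<sigma> k2 f xs vs = (\<lambda>(x, w).
     (x - f x + min (w + vs) (a - x),
      sat b_min b_max (w + \<sigma> * f x - \<sigma> * min (w + vs) (a - x) - k2 * (x - xs))))"

text \<open>The map need not leave the state space \<open>X\<close> invariant (for \<open>step\<close>, very negative \<open>w\<close>
  can push \<open>x\<close> below 0), so membership in \<open>X\<close> is required at every time.\<close>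

definition solution :: "'s set \<Rightarrow> ('s \<Rightarrow> 's) \<Rightarrow> (nat \<Rightarrow> 's) \<Rightarrow> bool" where
  "solution X F z \<longleftrightarrow> (\<forall>t. z t \<in> X \<and> z (Suc t) = F (z t))"

definition locally_exp_stable ::
  "'s::real_normed_vector set \<Rightarrow> ('s \<Rightarrow> 's) \<Rightarrow> 's \<Rightarrow> bool" where
  "locally_exp_stable X F p \<longleftrightarrow>
     (\<exists>\<delta>>0. \<exists>C\<ge>1. \<exists>\<mu>. 0 < \<mu> \<and> \<mu> < 1 \<and>
        (\<forall>z. solution X F z \<longrightarrow> norm (z 0 - p) < \<delta> \<longrightarrow>
           (\<forall>t. norm (z t - p) \<le> C * \<mu> ^ t * norm (z 0 - p))))"

definition is_maximum :: "real set \<Rightarrow> real \<Rightarrow> bool" where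
  "is_maximum S m \<longleftrightarrow> m \<in> S \<and> (\<forall>y\<in>S. y \<le> m)"

definition Omega :: "real \<Rightarrow> real \<Rightarrow> (real \<Rightarrow> real) \<Rightarrow> real \<Rightarrow> real \<Rightarrow> real \<Rightarrow> (real \<times> real) set" where
  "Omega a k2 f xs vs \<rho> =
     {(x, w). x \<in> {0..a} \<and>
        \<bar>x - xs\<bar> + (k2 + 1 - \<bar>1 - k2\<bar>) / k2 * \<bar>w + vs - f x + k2 * (x - xs)\<bar> < \<rho>}"

lemma step_equilibrium:
  assumes "f xs = us + vs" "f xs < a - xs" "b_min < us" "us < b_max"
  shows "step a b_min b_max \<sigma> k2 f xs vs (xs, us) = (xs, us)"
  using assms by (simp add: step_def sat_def)

end

theory Submission
  imports Defs
begin

text \<open>In the coordinates \<open>y = x - xs\<close>, \<open>e = w + vs - f x + k2 * y\<close>, as long as neither the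
  minimum nor the saturation is active, the system reads \<open>y' = (1 - k2) * y + e\<close> and
  \<open>e' = - (g x' - g x)\<close> with \<open>g x = f x - (1 - k1) * x\<close> and \<open>x' - x = e - k2 * y\<close>. If \<open>g\<close> is
  \<open>p\<close>-Lipschitz near \<open>xs\<close> with \<open>p < q\<close>, then \<open>V = \<bar>y\<bar> + c * \<bar>e\<bar>\<close> contracts by a factor below 1;
  the weight \<open>c\<close> is the one for which \<open>p = q\<close> would give exactly the factor 1 in both
  coordinates. On the sublevel set \<open>V < \<rho>\<close> the constraints are inactive. A solution starting
  with \<open>V = r < \<rho>\<close> stays within distance \<open>r < \<eta>\<close> of \<open>xs\<close>, where compactness gives \<open>p < q\<close>.\<close>

text \<open>The mean value inequality for \<open>f x - m * x\<close>. With \<open>m = 1 - k1\<close>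
  this function is \<open>g\<close>, whose increment is the only nonlinear term in the
  \<open>e\<close>-equation.\<close>

lemma tilted_lipschitz:
  fixes f f' :: "real \<Rightarrow> real"
  assumes "convex S"
    and "\<And>x. x \<in> S \<Longrightarrow> (f has_real_derivative f' x) (at x within S)"
    and "\<And>x. x \<in> S \<Longrightarrow> \<bar>f' x - m\<bar> \<le> p"
    and "x \<in> S" "y \<in> S"
  shows "\<bar>f x - f y - m * (x - y)\<bar> \<le> p * \<bar>x - y\<bar>"
proof -
  have "norm ((f x - m * x) - (f y - m * y)) \<le> p * norm (x - y)"
  proof (rule field_differentiable_bound[OF assms(1) _ _ assms(4,5)])
    fix z assume "z \<in> S"
    then show "((\<lambda>x. f x - m * x) has_field_derivative (f' z - m)) (at z within S)"
      by (auto intro!: derivative_eq_intros assms(2))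
    show "norm (f' z - m) \<le> p"
      using assms(3) \<open>z \<in> S\<close> by simp
  qed
  then show ?thesis
    by (simp add: algebra_simps)
qed

lemma step_unconstrained:
  assumes "w + vs \<le> a - x"
    and "w + \<sigma> * f x - \<sigma> * (w + vs) - k2 * (x - xs) \<in> {b_min..b_max}"
  shows "step a b_min b_max \<sigma> k2 f xs vs (x, w) =
    (x - f x + (w + vs), w + \<sigma> * f x - \<sigma> * (w + vs) - k2 * (x - xs))"
  using assms by (simp add: step_def sat_def)

text \<open>Writing y for \<open>x - xs\<close>, the excess of \<open>w + vs + x\<close> over its
  equilibrium value is the increment of \<open>g\<close> from \<open>xs\<close> plus
  \<open>y + (1 - \<sigma>) * y + e\<close>. Hence it is at most K |y| + |e|, where K is the
  denominator in the bound on V. Since K and \<open>c\<close> are at least 1, this is at most K V,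
  which is below the equilibrium slack \<open>a - vs - us - xs\<close>.\<close>

lemma min_constraint_inactive:
  fixes k1 k2 c q \<sigma> x xs w us vs a :: real and f :: "real \<Rightarrow> real"
  defines "e \<equiv> w + vs - f x + k2 * (x - xs)"
  assumes "\<sigma> = k1 + k2" and "f xs = us + vs" and "1 \<le> c" and "0 \<le> q"
    and lip: "\<bar>f x - f xs - (1 - k1) * (x - xs)\<bar> \<le> q * \<bar>x - xs\<bar>"
    and V: "\<bar>x - xs\<bar> + c * \<bar>e\<bar> < (a - vs - us - xs) / (1 + q + \<bar>\<sigma> - 1\<bar>)"
  shows "w + vs \<le> a - x"
proof -
  let ?y = "x - xs" and ?K = "1 + q + \<bar>\<sigma> - 1\<bar>"
  have "?K * (\<bar>?y\<bar> + c * \<bar>e\<bar>) < a - vs - us - xs"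
    using V \<open>0 \<le> q\<close> pos_less_divide_eq[of ?K] by (simp add: mult.commute add_pos_nonneg)
  moreover have "\<bar>e\<bar> \<le> ?K * (c * \<bar>e\<bar>)"
    using mult_mono[of 1 ?K "1 * \<bar>e\<bar>" "c * \<bar>e\<bar>"] mult_right_mono[of 1 c "\<bar>e\<bar>"]
      \<open>1 \<le> c\<close> \<open>0 \<le> q\<close> by simp
  moreover have "w + vs + x - (us + vs + xs)
      = (f x - f xs - (1 - k1) * ?y) + ?y + (1 - \<sigma>) * ?y + e"
    using assms(2,3) by (simp add: e_def algebra_simps)
  moreover have "(1 - \<sigma>) * ?y \<le> \<bar>\<sigma> - 1\<bar> * \<bar>?y\<bar>"
    using abs_ge_self[of "(1 - \<sigma>) * ?y"] by (simp add: abs_mult abs_minus_commute)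
  moreover have "f x - f xs - (1 - k1) * ?y \<le> q * \<bar>?y\<bar>"
    using lip by (rule abs_le_D1)
  moreover have "?K * (\<bar>?y\<bar> + c * \<bar>e\<bar>)
      = \<bar>?y\<bar> + q * \<bar>?y\<bar> + \<bar>\<sigma> - 1\<bar> * \<bar>?y\<bar> + ?K * (c * \<bar>e\<bar>)"
    by (simp only: distrib_left distrib_right mult_1_left)
  ultimately show ?thesis
    using abs_ge_self[of ?y] abs_ge_self[of e] by linarith
qed

text \<open>The argument of the saturation differs from \<open>us\<close> by a linear expression in
  y and \<open>e\<close> plus the increment of \<open>g\<close>. The two entries of the maximum are
  the resulting coefficients of |y| and of \<open>c\<close> |e|, so the difference is at most this
  maximum times V and cannot reach either saturation level.\<close>

lemma saturation_inactive:
  fixes k1 k2 c q \<sigma> x xs w us vs b_min b_max :: real and f :: "real \<Rightarrow> real"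
  defines "e \<equiv> w + vs - f x + k2 * (x - xs)"
  assumes "\<sigma> = k1 + k2" and "f xs = us + vs" and "0 < c" and "0 < q"
    and lip: "\<bar>f x - f xs - (1 - k1) * (x - xs)\<bar> \<le> q * \<bar>x - xs\<bar>"
    and V: "\<bar>x - xs\<bar> + c * \<bar>e\<bar>
      < min (b_max - us) (us - b_min) / max (\<bar>1 - \<sigma>\<bar> / c) (q + \<bar>(1 - \<sigma>) * (k2 - 1)\<bar>)"
  shows "w + \<sigma> * f x - \<sigma> * (w + vs) - k2 * (x - xs) \<in> {b_min..b_max}"
proof -
  let ?y = "x - xs" and ?M = "max (\<bar>1 - \<sigma>\<bar> / c) (q + \<bar>(1 - \<sigma>) * (k2 - 1)\<bar>)"
  let ?d = "w + \<sigma> * f x - \<sigma> * (w + vs) - k2 * ?y - us"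
  have "?M > 0"
    using \<open>0 < q\<close> by (simp add: less_max_iff_disj add_pos_nonneg)
  then have M: "?M * (\<bar>?y\<bar> + c * \<bar>e\<bar>) < min (b_max - us) (us - b_min)"
    using V by (simp only: pos_less_divide_eq mult.commute)
  have "?d = (f x - f xs - (1 - k1) * ?y) - (1 - \<sigma>) * (k2 - 1) * ?y + (1 - \<sigma>) * e"
    using assms(2,3) by (simp add: e_def algebra_simps)
  then have "\<bar>?d\<bar> \<le> \<bar>f x - f xs - (1 - k1) * ?y\<bar> + \<bar>(1 - \<sigma>) * (k2 - 1) * ?y\<bar> + \<bar>(1 - \<sigma>) * e\<bar>"
    by linarith
  also have "\<dots> \<le> (q + \<bar>(1 - \<sigma>) * (k2 - 1)\<bar>) * \<bar>?y\<bar> + \<bar>1 - \<sigma>\<bar> / c * (c * \<bar>e\<bar>)"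
    using lip \<open>0 < c\<close> by (simp add: abs_mult distrib_right)
  also have "\<dots> \<le> ?M * \<bar>?y\<bar> + ?M * (c * \<bar>e\<bar>)"
    using \<open>0 < c\<close> by (intro add_mono mult_right_mono) auto
  finally show ?thesis
    using M by (simp add: distrib_left abs_le_iff)
qed

text \<open>From \<open>x' - xs = (1 - k2) * y + e\<close> and |e'| <= p (|e| + k2 |y|), collecting
  terms gives one coefficient for |y| and one for \<open>c\<close> |e|. The contraction factor is
  the larger of the two.\<close>

lemma contraction:
  fixes k1 k2 c p \<sigma> x xs w vs x' w' :: real and f :: "real \<Rightarrow> real"
  defines "y \<equiv> x - xs" and "e \<equiv> w + vs - f x + k2 * (x - xs)"
  assumes "\<sigma> = k1 + k2" and "0 < k2" and "0 < c"
    and x': "x' = x - f x + (w + vs)"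
    and w': "w' = w + \<sigma> * f x - \<sigma> * (w + vs) - k2 * (x - xs)"
    and lip: "\<bar>f x' - f x - (1 - k1) * (x' - x)\<bar> \<le> p * \<bar>x' - x\<bar>" and "0 \<le> p"
  shows "\<bar>x' - xs\<bar> + c * \<bar>w' + vs - f x' + k2 * (x' - xs)\<bar>
    \<le> max (\<bar>1 - k2\<bar> + c * p * k2) (1 / c + p) * (\<bar>y\<bar> + c * \<bar>e\<bar>)"
proof -
  have y': "x' - xs = (1 - k2) * y + e" and d: "x' - x = e - k2 * y"
    by (simp_all add: x' y_def e_def algebra_simps)
  have "w' + vs - f x' + k2 * (x' - xs) = - (f x' - f x - (1 - k1) * (x' - x))"
    by (simp add: w' y' d y_def e_def \<open>\<sigma> = k1 + k2\<close> algebra_simps)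
  then have "\<bar>w' + vs - f x' + k2 * (x' - xs)\<bar> \<le> p * \<bar>e - k2 * y\<bar>"
    using lip d by simp
  also have "\<dots> \<le> p * (\<bar>e\<bar> + k2 * \<bar>y\<bar>)"
    using \<open>0 \<le> p\<close> \<open>0 < k2\<close> abs_triangle_ineq4[of e "k2 * y"]
    by (intro mult_left_mono) (simp_all add: abs_mult)
  finally have "c * \<bar>w' + vs - f x' + k2 * (x' - xs)\<bar> \<le> c * (p * (\<bar>e\<bar> + k2 * \<bar>y\<bar>))"
    using \<open>0 < c\<close> by simp
  moreover have "\<bar>x' - xs\<bar> \<le> \<bar>1 - k2\<bar> * \<bar>y\<bar> + \<bar>e\<bar>"
    unfolding y' using abs_triangle_ineq[of "(1 - k2) * y" e] by (simp add: abs_mult)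
  moreover have "\<bar>1 - k2\<bar> * \<bar>y\<bar> + \<bar>e\<bar> + c * (p * (\<bar>e\<bar> + k2 * \<bar>y\<bar>))
      = (\<bar>1 - k2\<bar> + c * p * k2) * \<bar>y\<bar> + (1 / c + p) * (c * \<bar>e\<bar>)"
    using \<open>0 < c\<close> by (simp add: field_simps)
  ultimately have "\<bar>x' - xs\<bar> + c * \<bar>w' + vs - f x' + k2 * (x' - xs)\<bar>
      \<le> (\<bar>1 - k2\<bar> + c * p * k2) * \<bar>y\<bar> + (1 / c + p) * (c * \<bar>e\<bar>)"
    by linarith
  also have "\<dots> \<le> max (\<bar>1 - k2\<bar> + c * p * k2) (1 / c + p) * \<bar>y\<bar>
      + max (\<bar>1 - k2\<bar> + c * p * k2) (1 / c + p) * (c * \<bar>e\<bar>)"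
    using \<open>0 < c\<close> by (intro add_mono mult_right_mono) auto
  finally show ?thesis
    by (simp add: distrib_left)
qed

text \<open>The decrease is assumed only below level \<open>r\<close>, so the induction must carry
  the trapping bound together with the geometric rate.\<close>

lemma geometric_decay:
  fixes v :: "nat \<Rightarrow> real"
    and r \<kappa> :: real
  assumes "\<And>t. v t \<le> r \<Longrightarrow> v (Suc t) \<le> \<kappa> * v t" and "v 0 \<le> r"
    and "\<And>t. 0 \<le> v t" and "0 \<le> \<kappa>" "\<kappa> < 1"
  shows "v t \<le> r" and "v \<longlonglongrightarrow> 0"
proof -
  have *: "v t \<le> r \<and> v t \<le> \<kappa> ^ t * v 0" for t
  proof (induction t)
    case (Suc t)
    then have "v (Suc t) \<le> \<kappa> * v t"
      using assms(1) by blast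
    moreover have "\<kappa> * v t \<le> v t"
      using assms(3)[of t] assms(5) by (simp add: mult_left_le_one_le assms(4))
    moreover have "\<kappa> * v t \<le> \<kappa> * (\<kappa> ^ t * v 0)"
      using Suc assms(4) by (intro mult_left_mono) auto
    ultimately show ?case
      using Suc by (auto simp: mult.assoc)
  qed (use assms(2) in simp)
  show "v t \<le> r"
    using * by blast
  have "(\<lambda>t. \<kappa> ^ t * v 0) \<longlonglongrightarrow> 0"
    by (rule tendsto_mult_left_zero[OF LIMSEQ_realpow_zero[OF assms(4,5)]])
  then show "v \<longlonglongrightarrow> 0"
    by (rule tendsto_sandwich[rotated 3, where f = "\<lambda>_. 0"])
      (auto intro!: always_eventually simp: * assms(3))
qed

theorem proposition2p2:
  fixes a b_min b_max k1 k2 xs us vs \<sigma> q \<eta> \<rho> :: real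
    and f f' :: "real \<Rightarrow> real"
  assumes "a > 0" and "0 \<le> b_min" and "b_min < b_max"
    and "\<And>x. x \<in> {0..a} \<Longrightarrow> (f has_real_derivative f' x) (at x within {0..a})"
    and "continuous_on {0..a} f'"
    and "\<And>x. x \<in> {0..a} \<Longrightarrow> 0 \<le> f x \<and> f x \<le> x"
    and "xs \<in> {0<..<a}" and "us \<in> {b_min<..<b_max}" and "vs \<ge> 0"
    and "f xs = us + vs" and "f xs < a - xs"
    and "\<sigma> = k1 + k2"
    and "locally_exp_stable ({0..a} \<times> UNIV) (step a b_min b_max \<sigma> k2 f xs vs) (xs, us)"
    and "0 < k2" and "k2 < 2"
    and "q = (1 - \<bar>1 - k2\<bar>) / (k2 + 1 - \<bar>1 - k2\<bar>)"
    and "\<bar>f' xs - 1 + k1\<bar> < q"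
    and "\<eta> > 0"
    and "is_maximum {\<bar>f' x - 1 + k1\<bar> | x. x \<in> {0..a} \<and> \<bar>x - xs\<bar> \<le> \<eta>} q"
    and "\<And>x. x \<in> {0..a} \<Longrightarrow> \<bar>x - xs\<bar> < \<eta> \<Longrightarrow> \<bar>f' x - 1 + k1\<bar> < q"
    and "\<rho> = min \<eta> (min
           (min (b_max - us) (us - b_min) /
              max (k2 * \<bar>1 - \<sigma>\<bar> / (k2 + 1 - \<bar>1 - k2\<bar>)) (q + \<bar>(1 - \<sigma>) * (k2 - 1)\<bar>))
           ((a - vs - us - xs) / (1 + q + \<bar>\<sigma> - 1\<bar>)))"
  shows "\<forall>z. solution ({0..a} \<times> UNIV) (step a b_min b_max \<sigma> k2 f xs vs) z
           \<longrightarrow> z 0 \<in> Omega a k2 f xs vs \<rho> \<longrightarrow> z \<longlonglongrightarrow> (xs, us)"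
proof (intro allI impI)
  fix z
  assume sol: "solution ({0..a} \<times> UNIV) (step a b_min b_max \<sigma> k2 f xs vs) z"
    and init: "z 0 \<in> Omega a k2 f xs vs \<rho>"
  define c where "c = (k2 + 1 - \<bar>1 - k2\<bar>) / k2"
  define x where "x t = fst (z t)" for t
  define w where "w t = snd (z t)" for t
  define e where "e t = w t + vs - f (x t) + k2 * (x t - xs)" for t
  define V where "V t = \<bar>x t - xs\<bar> + c * \<bar>e t\<bar>" for t
  have z: "z t = (x t, w t)" for t
    by (simp add: x_def w_def)
  have x_mem: "x t \<in> {0..a}"
    and step: "(x (Suc t), w (Suc t)) = step a b_min b_max \<sigma> k2 f xs vs (x t, w t)" for t
    using sol by (auto simp: solution_def mem_Times_iff x_def w_def)
  have pos: "0 < 1 - \<bar>1 - k2\<bar>"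
    using \<open>0 < k2\<close> \<open>k2 < 2\<close> by linarith
  have D: "0 < k2 + 1 - \<bar>1 - k2\<bar>"
    using pos \<open>0 < k2\<close> by linarith
  have "1 < c" and "0 < q"
    using pos D \<open>0 < k2\<close> by (simp_all add: c_def \<open>q = _\<close>)
  \<comment> \<open>The next two identities say that both coefficients in \<open>contraction\<close>
    equal 1 at \<open>p = q\<close>. Solving them for \<open>c\<close> and \<open>q\<close> yields
    the given formulas.\<close>
  have cq: "c * q * k2 = 1 - \<bar>1 - k2\<bar>"
    using D \<open>0 < k2\<close> by (simp add: c_def \<open>q = _\<close>)
  have ccq: "1 / c + q = 1"
    using D by (simp add: c_def \<open>q = _\<close> flip: add_divide_distrib)
  have V_nonneg: "0 \<le> V t" for t
    using \<open>1 < c\<close> by (simp add: V_def)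
  define r where "r = V 0"
  have "r < \<rho>"
    using init by (simp add: z Omega_def r_def V_def e_def c_def)
  \<comment> \<open>By the choice of \<open>c\<close>, the first entry of the maximum in
    \<open>\<rho>\<close> is |1 - \<sigma>| / c, the form used in
    \<open>saturation_inactive\<close>.\<close>
  have "r < \<eta>"
    and sat_bound: "r < min (b_max - us) (us - b_min)
      / max (\<bar>1 - \<sigma>\<bar> / c) (q + \<bar>(1 - \<sigma>) * (k2 - 1)\<bar>)"
    and min_bound: "r < (a - vs - us - xs) / (1 + q + \<bar>\<sigma> - 1\<bar>)"
    using \<open>r < \<rho>\<close> unfolding \<open>\<rho> = _\<close> c_def by (simp_all add: mult.commute)

  \<comment> \<open>The radius is the initial value of V, which bounds |x - xs|. Since
    \<open>r < \<eta>\<close>, the closed set \<open>S\<close> lies where the strict derivative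
    bound holds.\<close>
  define S where "S = {0..a} \<inter> cball xs r"
  have S_iff: "u \<in> S \<longleftrightarrow> u \<in> {0..a} \<and> \<bar>u - xs\<bar> \<le> r" for u
    by (auto simp: S_def dist_real_def)
  have "0 \<le> r"
    using V_nonneg by (simp add: r_def)
  then have "xs \<in> S"
    using \<open>xs \<in> {0<..<a}\<close> by (auto simp: S_iff)
  \<comment> \<open>The strict pointwise bound becomes uniform: the supremum over the compact set
    \<open>S\<close> is attained, hence is still below \<open>q\<close>.\<close>
  obtain p where "0 \<le> p" "p < q" and p: "\<And>u. u \<in> S \<Longrightarrow> \<bar>f' u - (1 - k1)\<bar> \<le> p"
  proof -
    have "compact S"
      unfolding S_def by (intro compact_Int) auto
    moreover have "continuous_on S (\<lambda>u. \<bar>f' u - (1 - k1)\<bar>)"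
      using \<open>continuous_on {0..a} f'\<close>
      by (intro continuous_intros) (auto simp: S_def intro: continuous_on_subset)
    ultimately obtain m where "m \<in> S"
      and m: "\<And>u. u \<in> S \<Longrightarrow> \<bar>f' u - (1 - k1)\<bar> \<le> \<bar>f' m - (1 - k1)\<bar>"
      using continuous_attains_sup[of S] \<open>xs \<in> S\<close> by blast
    have "\<bar>f' m - 1 + k1\<bar> < q"
      using \<open>m \<in> S\<close> \<open>r < \<eta>\<close> by (intro assms(20)) (auto simp: S_iff)
    then have "\<bar>f' m - (1 - k1)\<bar> < q"
      by (simp add: algebra_simps)
    then show thesis
      using that[of "\<bar>f' m - (1 - k1)\<bar>"] m by simp
  qed
  have "convex S"
    unfolding S_def by (intro convex_Int) auto
  have deriv: "(f has_real_derivative f' u) (at u within S)" if "u \<in> S" for u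
    using assms(4)[of u] that by (auto simp: S_def intro: DERIV_subset)
  have lip: "\<bar>f u - f v - (1 - k1) * (u - v)\<bar> \<le> p * \<bar>u - v\<bar>" if "u \<in> S" "v \<in> S" for u v
    using tilted_lipschitz[OF \<open>convex S\<close> deriv p] that by simp
  \<comment> \<open>The bounds in \<open>\<rho>\<close> are expressed through \<open>q\<close>, so
    the constant \<open>p\<close> is relaxed here.\<close>
  have lip_xs: "\<bar>f u - f xs - (1 - k1) * (u - xs)\<bar> \<le> q * \<bar>u - xs\<bar>" if "u \<in> S" for u
    using lip[OF that \<open>xs \<in> S\<close>] \<open>p < q\<close> by (smt (verit) mult_right_mono abs_ge_zero)

  define \<kappa> where "\<kappa> = max (\<bar>1 - k2\<bar> + c * p * k2) (1 / c + p)"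
  have "0 \<le> \<kappa>"
    using \<open>0 \<le> p\<close> \<open>1 < c\<close> by (simp add: \<kappa>_def le_max_iff_disj)
  \<comment> \<open>Both coefficients increase strictly with \<open>p\<close>, so they fall below
    their value 1 at \<open>q\<close>.\<close>
  have "c * p * k2 < c * q * k2"
    using \<open>p < q\<close> \<open>1 < c\<close> \<open>0 < k2\<close> by simp
  then have "\<kappa> < 1"
    using cq ccq \<open>p < q\<close> by (auto simp: \<kappa>_def)

  have x_in_S: "x t \<in> S" if "V t \<le> r" for t
  proof -
    have "\<bar>x t - xs\<bar> \<le> V t"
      using \<open>1 < c\<close> by (simp add: V_def)
    then show ?thesis
      using that x_mem[of t] by (auto simp: S_iff)
  qed
  have decrease: "V (Suc t) \<le> \<kappa> * V t" if "V t \<le> r" for t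
  proof -
    have S: "x t \<in> S"
      using x_in_S[OF that] .
    have V_t: "\<bar>x t - xs\<bar> + c * \<bar>w t + vs - f (x t) + k2 * (x t - xs)\<bar> \<le> r"
      using that by (simp add: V_def e_def)
    have "0 < c" "1 \<le> c" "0 \<le> q"
      using \<open>1 < c\<close> \<open>0 < q\<close> by simp_all
    note \<sigma> = \<open>\<sigma> = k1 + k2\<close> and fxs = \<open>f xs = us + vs\<close>
    have "w t + vs \<le> a - x t"
      by (rule min_constraint_inactive[where f = f, OF \<sigma> fxs \<open>1 \<le> c\<close> \<open>0 \<le> q\<close> lip_xs[OF S]
            le_less_trans[OF V_t min_bound]])
    moreover have "w t + \<sigma> * f (x t) - \<sigma> * (w t + vs) - k2 * (x t - xs) \<in> {b_min..b_max}"
      by (rule saturation_inactive[where f = f, OF \<sigma> fxs \<open>0 < c\<close> \<open>0 < q\<close> lip_xs[OF S]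
            le_less_trans[OF V_t sat_bound]])
    ultimately have x': "x (Suc t) = x t - f (x t) + (w t + vs)"
      and w': "w (Suc t) = w t + \<sigma> * f (x t) - \<sigma> * (w t + vs) - k2 * (x t - xs)"
      using step[of t] by (simp_all add: step_unconstrained)
    \<comment> \<open>The next point must be placed in \<open>S\<close> before the decrease of V is
      known, because \<open>contraction\<close> uses the Lipschitz bound between \<open>x t\<close>
      and \<open>x (Suc t)\<close>. The linear equation suffices: |1 - k2| < 1 < c bounds the new
      distance to \<open>xs\<close> by \<open>V t\<close>.\<close>
    have "x (Suc t) - xs = (1 - k2) * (x t - xs) + e t"
      by (simp add: x' e_def algebra_simps)
    then have "\<bar>x (Suc t) - xs\<bar> \<le> \<bar>1 - k2\<bar> * \<bar>x t - xs\<bar> + \<bar>e t\<bar>"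
      using abs_triangle_ineq[of "(1 - k2) * (x t - xs)" "e t"] by (simp add: abs_mult)
    also have "\<dots> \<le> 1 * \<bar>x t - xs\<bar> + c * \<bar>e t\<bar>"
      using pos \<open>1 < c\<close> by (intro add_mono mult_right_mono mult_le_cancel_right1[THEN iffD2]) auto
    finally have x_Suc: "x (Suc t) \<in> S"
      using that x_mem[of "Suc t"] by (simp add: S_iff V_def)
    show ?thesis
      unfolding V_def e_def \<kappa>_def
      by (rule contraction[where f = f, OF \<sigma> \<open>0 < k2\<close> \<open>0 < c\<close> x' w' lip[OF x_Suc S] \<open>0 \<le> p\<close>])
  qed
  have decay: "V t \<le> r" "V \<longlonglongrightarrow> 0" for t
    by (rule geometric_decay[where v = V and r = r and \<kappa> = \<kappa>];
        use decrease V_nonneg \<open>0 \<le> \<kappa>\<close> \<open>\<kappa> < 1\<close> r_def in simp)+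
  have y_lim: "(\<lambda>t. x t - xs) \<longlonglongrightarrow> 0"
    using \<open>1 < c\<close> by (intro Lim_null_comparison[OF _ decay(2)]) (simp add: V_def)
  then have x_lim: "x \<longlonglongrightarrow> xs"
    by (simp add: LIM_zero_iff)
  have "(\<lambda>t. c * e t) \<longlonglongrightarrow> 0"
    using \<open>1 < c\<close> by (intro Lim_null_comparison[OF _ decay(2)]) (simp add: V_def abs_mult)
  then have e_lim: "e \<longlonglongrightarrow> 0"
    using \<open>1 < c\<close> tendsto_mult_left_iff[of c e 0] by simp
  \<comment> \<open>Returning from \<open>e\<close> to \<open>w\<close> adds \<open>f (x t)\<close>,
    so its limit is needed as well.\<close>
  have "continuous_on S f"
    unfolding continuous_on_eq_continuous_within using deriv DERIV_continuous by blast
  from continuous_on_tendsto_compose[OF this x_lim \<open>xs \<in> S\<close>]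
  have "(\<lambda>t. f (x t)) \<longlonglongrightarrow> f xs"
    using x_in_S[OF decay(1)] by simp
  then have "(\<lambda>t. e t - vs + f (x t) - k2 * (x t - xs)) \<longlonglongrightarrow> 0 - vs + f xs - k2 * 0"
    by (intro tendsto_intros e_lim y_lim)
  moreover have "e t - vs + f (x t) - k2 * (x t - xs) = w t" for t
    by (simp add: e_def)
  ultimately have "w \<longlonglongrightarrow> us"
    using \<open>f xs = us + vs\<close> by simp
  then have "(\<lambda>t. (x t, w t)) \<longlonglongrightarrow> (xs, us)"
    using x_lim by (intro tendsto_Pair)
  then show "z \<longlonglongrightarrow> (xs, us)"
    by (simp flip: z)
qed

end
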